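(* Let $\eta>0$, let $G=(V,E)$ be a graph of arboricity at most $\alpha$, and set $\Lambda:=(1+1/\eta)\cdot 2\alpha$. Let $V_>^\Lambda=\{v\in V:\deg(v)>\Lambda\}$, $V_\le^\Lambda=\{v\in V:\deg(v)\le\Lambda\}$, and $G_\le^\Lambda=(V,E[V_\le^\Lambda])$, where $E[U]$ denotes the edges with both endpoints in $U$. Let $H$ be any graph with $G_\le^\Lambda\preceq H\preceq G$, where $\preceq$ is the subgraph relation. If $C$ is a $(\beta,\zeta)$-approximate vertex cover of $H$, then $C\cup V_>^\Lambda$ is a vertex cover of $G$ of cardinality at most $(1+\beta+\eta)\,\mathrm{OPT}(G)+\zeta$.
   Context: Degrees are taken in $G$. Arboricity is the minimum number of forests partitioning the edge set. $\mathrm{OPT}(\cdot)$ is the minimum vertex cover size. A $(\beta,\zeta)$-approximate vertex cover of $H$ is a vertex cover of $H$ of size at most $\beta\,\mathrm{OPT}(H)+\zeta$.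
   Formalization: The approximation factor β is assumed to be nonnegative; without this the bound fails (e.g. a star K_{1,5} with η=1, α=1, H edgeless, C empty, β=-10, ζ=0). *)

theory Defs
  imports Complex_Main "HOL-Library.Disjoint_Sets"
begin

record 'a ugraph =
  verts :: "'a set"
  edges :: "'a set set"

definition simple_graph :: "'a ugraph \<Rightarrow> bool" where
  "simple_graph G \<longleftrightarrow>
     finite (verts G) \<and> (\<forall>e\<in>edges G. e \<subseteq> verts G \<and> card e = 2)"

definition subgraph :: "'a ugraph \<Rightarrow> 'a ugraph \<Rightarrow> bool"  (infix \<open>\<preceq>\<close> 50) where
  "H \<preceq> G \<longleftrightarrow> verts H \<subseteq> verts G \<and> edges H \<subseteq> edges G"

definition degree :: "'a ugraph \<Rightarrow> 'a \<Rightarrow> nat" where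
  "degree G v = card {e \<in> edges G. v \<in> e}"

definition edges_within :: "'a ugraph \<Rightarrow> 'a set \<Rightarrow> 'a set set" where
  "edges_within G U = {e \<in> edges G. e \<subseteq> U}"

(* A cycle is given by the cyclic sequence of its (at least three, pairwise distinct) vertices. *)
definition is_cycle :: "'a ugraph \<Rightarrow> 'a list \<Rightarrow> bool" where
  "is_cycle G vs \<longleftrightarrow>
     length vs \<ge> 3 \<and> distinct vs \<and>
     (\<forall>i<length vs. {vs ! i, vs ! (Suc i mod length vs)} \<in> edges G)"

definition forest :: "'a ugraph \<Rightarrow> bool" where
  "forest G \<longleftrightarrow> simple_graph G \<and> (\<nexists>vs. is_cycle G vs)"

(* The minimum is attained for every finite simple graph: single edges form forests. *)
definition arboricity :: "'a ugraph \<Rightarrow> nat" where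
  "arboricity G =
     (LEAST k. \<exists>P. partition_on (edges G) P \<and> finite P \<and> card P = k \<and>
        (\<forall>F\<in>P. forest \<lparr>verts = verts G, edges = F\<rparr>))"

definition vertex_cover :: "'a ugraph \<Rightarrow> 'a set \<Rightarrow> bool" where
  "vertex_cover G C \<longleftrightarrow> C \<subseteq> verts G \<and> (\<forall>e\<in>edges G. e \<inter> C \<noteq> {})"

definition OPT :: "'a ugraph \<Rightarrow> nat" where
  "OPT G = (LEAST k. \<exists>C. vertex_cover G C \<and> card C = k)"

definition approx_vertex_cover :: "real \<Rightarrow> real \<Rightarrow> 'a ugraph \<Rightarrow> 'a set \<Rightarrow> bool" where
  "approx_vertex_cover \<beta> \<zeta> H C \<longleftrightarrow>
     vertex_cover H C \<and> real (card C) \<le> \<beta> * real (OPT H) + \<zeta>"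

definition high_verts :: "'a ugraph \<Rightarrow> real \<Rightarrow> 'a set" where
  "high_verts G \<Lambda> = {v \<in> verts G. real (degree G v) > \<Lambda>}"

definition low_verts :: "'a ugraph \<Rightarrow> real \<Rightarrow> 'a set" where
  "low_verts G \<Lambda> = {v \<in> verts G. real (degree G v) \<le> \<Lambda>}"

definition low_graph :: "'a ugraph \<Rightarrow> real \<Rightarrow> 'a ugraph" where
  "low_graph G \<Lambda> = \<lparr>verts = verts G, edges = edges_within G (low_verts G \<Lambda>)\<rparr>"

end

theory Submission
  imports Defs
begin

text \<open>
  Let \<open>O\<close> be a minimum vertex cover of \<open>G\<close> and \<open>X\<close> the set of high-degree vertices outside \<open>O\<close>.
  Every edge meeting \<open>X\<close> has exactly one endpoint in \<open>X\<close>, the other lying in \<open>O\<close>, so the degrees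
  over \<open>X\<close> sum to at most the number of edges inside \<open>X \<union> O\<close>. A forest on \<open>n\<close> vertices has at
  most \<open>n\<close> edges, so this number is at most \<open>\<alpha> (|X| + |O|)\<close>. As every degree over \<open>X\<close> exceeds
  \<open>\<Lambda> \<ge> (1 + 1/\<eta>) \<alpha>\<close>, it follows that \<open>|X| \<le> \<eta> |O|\<close>.
\<close>

section \<open>Edge counts of forests\<close>

lemma simple_graph_finite_edges: "simple_graph G \<Longrightarrow> finite (edges G)"
  by (rule finite_subset[of _ "Pow (verts G)"]) (auto simp: simple_graph_def)

text \<open>A longest path closes up to a cycle at its first vertex: all neighbours of that vertex lie on
  the path, and one of them is not its successor.\<close>

lemma min_degree_two_imp_cycle:
  assumes G: "simple_graph G" and ne: "verts G \<noteq> {}"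
    and deg: "\<And>v. v \<in> verts G \<Longrightarrow> degree G v \<ge> 2"
  shows "\<exists>vs. is_cycle G vs"
proof -
  define path where "path vs \<longleftrightarrow> vs \<noteq> [] \<and> distinct vs \<and> set vs \<subseteq> verts G \<and>
    (\<forall>i. Suc i < length vs \<longrightarrow> {vs ! i, vs ! Suc i} \<in> edges G)" for vs
  have fin: "finite (verts G)" using G by (simp add: simple_graph_def)
  obtain v0 where "v0 \<in> verts G" using ne by blast
  then have "path [v0]" by (simp add: path_def)
  moreover have "\<forall>vs. path vs \<longrightarrow> length vs < Suc (card (verts G))"
    unfolding path_def by (metis card_mono distinct_card fin less_Suc_eq_le)
  ultimately obtain vs where vs: "path vs" and longest: "\<And>ws. path ws \<Longrightarrow> length ws \<le> length vs"
    using ex_has_greatest_nat[of path "[v0]" length] by blast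
  define v where "v = hd vs"
  have v0: "vs ! 0 = v" and vV: "v \<in> verts G"
    using vs by (auto simp: path_def v_def hd_conv_nth)
  \<comment> \<open>If the path has only one vertex, \<open>vs ! 1\<close> is an unspecified value;
    this is harmless, since only the fact that the right-hand side is a singleton matters.\<close>
  have "\<not> {e \<in> edges G. v \<in> e} \<subseteq> {{v, vs ! 1}}"
  proof
    assume "{e \<in> edges G. v \<in> e} \<subseteq> {{v, vs ! 1}}"
    then have "degree G v \<le> card {{v, vs ! 1}}"
      unfolding degree_def by (intro card_mono) auto
    then show False using deg[OF vV] by simp
  qed
  then obtain e where e: "e \<in> edges G" "v \<in> e" "e \<noteq> {v, vs ! 1}" by blast
  then obtain w where w: "e = {v, w}" "w \<noteq> v"
    using G unfolding simple_graph_def by (metis card_2_iff insert_commute insertE singletonD)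
  have wV: "w \<in> verts G" using G e w by (auto simp: simple_graph_def)
  have "w \<in> set vs"
  proof (rule ccontr)
    assume "w \<notin> set vs"
    then have "path (w # vs)"
      using vs e w wV v0 unfolding path_def
      by (auto simp: nth_Cons insert_commute split: nat.split)
    then show False using longest by force
  qed
  then obtain j where j: "j < length vs" "vs ! j = w" by (meson in_set_conv_nth)
  \<comment> \<open>Index 0 would give \<open>w = v\<close> and index 1 the excluded edge. So the
    initial segment of the path ending in \<open>w\<close> has at least three vertices, and
    \<open>e\<close> closes it to a cycle.\<close>
  have "j \<noteq> 0" "j \<noteq> 1" using j v0 w e by auto
  then have j2: "j \<ge> 2" by simp
  have "is_cycle G (take (Suc j) vs)"
    unfolding is_cycle_def
  proof (intro conjI allI impI)
    show "3 \<le> length (take (Suc j) vs)" using j j2 by simp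
    show "distinct (take (Suc j) vs)" using vs by (simp add: path_def)
    fix i assume "i < length (take (Suc j) vs)"
    then have i: "i \<le> j" and len: "length (take (Suc j) vs) = Suc j" using j by auto
    show "{take (Suc j) vs ! i, take (Suc j) vs ! (Suc i mod length (take (Suc j) vs))} \<in> edges G"
    proof (cases "i = j")
      case True
      then show ?thesis using len j v0 e w by (simp add: insert_commute)
    next
      case False
      then show ?thesis using i len j vs by (simp add: path_def)
    qed
  qed
  then show ?thesis by blast
qed

lemma forest_subgraph:
  assumes "forest G" "H \<preceq> G" "simple_graph H"
  shows "forest H"
  using assms unfolding forest_def subgraph_def is_cycle_def by blast

text \<open>Without a cycle some vertex has degree at most one. Deleting it loses at most one edge
  and leaves a forest, so induction applies. Bounding by the number n of vertices rather than n - 1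
  keeps the empty graph as base case.\<close>

lemma forest_card_edges_le:
  assumes "forest G"
  shows "card (edges G) \<le> card (verts G)"
  using assms
proof (induction "card (verts G)" arbitrary: G)
  case 0
  then have "edges G = {}"
    by (auto simp: forest_def simple_graph_def)
  then show ?case by simp
next
  case (Suc n)
  then have G: "simple_graph G" by (simp add: forest_def)
  have "verts G \<noteq> {}" using Suc.hyps(2) by force
  then obtain v where v: "v \<in> verts G" "degree G v \<le> 1"
    using min_degree_two_imp_cycle[OF G] Suc.prems unfolding forest_def
    by (metis Suc_1 not_less_eq_eq)
  define G' :: "'a ugraph" where "G' = \<lparr>verts = verts G - {v}, edges = {e \<in> edges G. v \<notin> e}\<rparr>"
  have "simple_graph G'" using G by (auto simp: G'_def simple_graph_def)
  then have "forest G'"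
    using Suc.prems by (rule_tac forest_subgraph[of G]) (auto simp: subgraph_def G'_def)
  moreover have n: "card (verts G') = n" using Suc.hyps(2) v by (simp add: G'_def)
  ultimately have "card (edges G') \<le> n" using Suc.hyps(1)[of G'] by simp
  moreover have "edges G = edges G' \<union> {e \<in> edges G. v \<in> e}" by (auto simp: G'_def)
  then have "card (edges G) \<le> card (edges G') + degree G v"
    unfolding degree_def by (metis card_Un_le)
  ultimately show ?case using v Suc.hyps(2) by simp
qed

section \<open>Arboricity as a bound on edge counts of vertex subsets\<close>

lemma forest_single_edge:
  assumes "simple_graph G" "e \<in> edges G"
  shows "forest \<lparr>verts = verts G, edges = {e}\<rparr>"
  unfolding forest_def
proof
  show "simple_graph \<lparr>verts = verts G, edges = {e}\<rparr>"
    using assms by (simp add: simple_graph_def)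
  show "\<nexists>vs. is_cycle \<lparr>verts = verts G, edges = {e}\<rparr> vs"
  proof
    assume "\<exists>vs. is_cycle \<lparr>verts = verts G, edges = {e}\<rparr> vs"
    then obtain vs where len: "length vs \<ge> 3" and dist: "distinct vs"
      and adj: "\<And>i. i < length vs \<Longrightarrow> {vs ! i, vs ! (Suc i mod length vs)} = e"
      by (auto simp: is_cycle_def)
    have ne: "vs \<noteq> []" using len by auto
    \<comment> \<open>With at least three vertices, the first two edges of the cycle do not wrap
      around; both would equal \<open>e\<close>, although \<open>vs ! 0\<close> lies only in the
      first.\<close>
    then have "{vs ! 0, vs ! 1} = {vs ! 1, vs ! 2}"
      using adj[of 0] adj[of 1] len by (simp add: numeral_2_eq_2)
    moreover have "vs ! 0 \<noteq> vs ! 1" "vs ! 0 \<noteq> vs ! 2"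
      using dist len ne by (auto simp: nth_eq_iff_index_eq)
    ultimately show False by blast
  qed
qed

text \<open>The \<open>LEAST\<close> in \<open>arboricity\<close> is meaningful only if some
  partition into forests exists; the partition into single edges is one.\<close>

lemma arboricity_attained:
  assumes "simple_graph G"
  obtains P where "partition_on (edges G) P" "finite P" "card P = arboricity G"
    "\<And>F. F \<in> P \<Longrightarrow> forest \<lparr>verts = verts G, edges = F\<rparr>"
proof -
  let ?Q = "\<lambda>k. \<exists>P. partition_on (edges G) P \<and> finite P \<and> card P = k \<and>
        (\<forall>F\<in>P. forest \<lparr>verts = verts G, edges = F\<rparr>)"
  let ?S = "(\<lambda>e. {e}) ` edges G"
  have "partition_on (edges G) ?S"
    by (auto simp: partition_on_def disjoint_def)
  then have "?Q (card ?S)"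
    using assms forest_single_edge simple_graph_finite_edges by blast
  then have "?Q (arboricity G)"
    unfolding arboricity_def by (rule LeastI)
  then show ?thesis using that by blast
qed

text \<open>This is the easy direction of the Nash-Williams theorem, in slightly weaker form. Each
  class of an optimal partition, cut down to the edges inside \<open>U\<close>, is a forest on the
  vertex set \<open>U\<close> and so has at most |U| edges.\<close>

lemma card_edges_within_le_arboricity:
  assumes G: "simple_graph G" and U: "U \<subseteq> verts G"
  shows "card (edges_within G U) \<le> arboricity G * card U"
proof -
  obtain P where P: "partition_on (edges G) P" "finite P" "card P = arboricity G"
    and forests: "\<And>F. F \<in> P \<Longrightarrow> forest \<lparr>verts = verts G, edges = F\<rparr>"
    using arboricity_attained[OF G] by blast
  have bound: "card {e \<in> F. e \<subseteq> U} \<le> card U" if "F \<in> P" for F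
  proof -
    have "simple_graph \<lparr>verts = U, edges = {e \<in> F. e \<subseteq> U}\<rparr>"
      using forests[OF that] U by (auto simp: forest_def simple_graph_def intro: finite_subset)
    then have "forest \<lparr>verts = U, edges = {e \<in> F. e \<subseteq> U}\<rparr>"
      using U by (intro forest_subgraph[OF forests[OF that]]) (auto simp: subgraph_def)
    from forest_card_edges_le[OF this] show ?thesis by simp
  qed
  have "edges_within G U = (\<Union>F\<in>P. {e \<in> F. e \<subseteq> U})"
    using partition_onD1[OF P(1)] by (auto simp: edges_within_def)
  then have "card (edges_within G U) \<le> (\<Sum>F\<in>P. card {e \<in> F. e \<subseteq> U})"
    using card_UN_le[OF P(2)] by simp
  also have "\<dots> \<le> card P * card U"
    using sum_bounded_above[of P "\<lambda>F. card {e \<in> F. e \<subseteq> U}", OF bound] by simp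
  finally show ?thesis using P(3) by simp
qed

section \<open>Minimum vertex covers\<close>

lemma OPT_attained:
  assumes "simple_graph G"
  obtains C where "vertex_cover G C" "card C = OPT G"
proof -
  have "e \<inter> verts G \<noteq> {}" if "e \<in> edges G" for e
    using assms that unfolding simple_graph_def by (metis card.empty inf.absorb1 zero_neq_numeral)
  then have "vertex_cover G (verts G)" by (simp add: vertex_cover_def)
  then have "\<exists>C. vertex_cover G C \<and> card C = OPT G"
    unfolding OPT_def by (intro LeastI) blast
  then show ?thesis using that by blast
qed

lemma OPT_le_card: "vertex_cover G C \<Longrightarrow> OPT G \<le> card C"
  unfolding OPT_def by (rule Least_le) blast

section \<open>High-degree vertices outside a cover\<close>

lemma sum_degree_outside_cover_le:
  assumes G: "simple_graph G" and cover: "vertex_cover G K"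
    and X: "X \<subseteq> verts G" "X \<inter> K = {}"
  shows "(\<Sum>v\<in>X. degree G v) \<le> arboricity G * (card X + card K)"
proof -
  have finE: "finite (edges G)" by (rule simple_graph_finite_edges[OF G])
  have finV: "finite (verts G)" using G by (simp add: simple_graph_def)
  have KV: "K \<subseteq> verts G" using cover by (simp add: vertex_cover_def)
  have finX: "finite X" and finK: "finite K"
    using X KV finV by (auto intro: finite_subset)
  have edge: "\<exists>w\<in>K. e = {v, w}" if e: "e \<in> edges G" "v \<in> e" "v \<in> X" for e v
  proof -
    obtain w where w: "w \<in> e" "w \<in> K" using cover e by (auto simp: vertex_cover_def)
    moreover have "v \<noteq> w" using w X e by blast
    moreover have "card e = 2" using G e by (simp add: simple_graph_def)
    ultimately have "e = {v, w}" using e(2) by (auto simp: card_2_iff)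
    then show ?thesis using w by blast
  qed
  \<comment> \<open>An edge at \<open>v\<close> has its other endpoint in \<open>K\<close>, hence
    outside \<open>X\<close>. So the degree sum counts no edge twice and equals the size of a
    union.\<close>
  have disj: "{e \<in> edges G. v \<in> e} \<inter> {e \<in> edges G. u \<in> e} = {}"
    if "v \<in> X" "u \<in> X" "v \<noteq> u" for u v
    using edge[of _ v] that X by blast
  have "(\<Sum>v\<in>X. degree G v) = card (\<Union>v\<in>X. {e \<in> edges G. v \<in> e})"
    unfolding degree_def using finX finE disj by (subst card_UN_disjoint) auto
  also have "\<dots> \<le> card (edges_within G (X \<union> K))"
  proof (rule card_mono)
    show "finite (edges_within G (X \<union> K))" using finE by (simp add: edges_within_def)
    show "(\<Union>v\<in>X. {e \<in> edges G. v \<in> e}) \<subseteq> edges_within G (X \<union> K)"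
      unfolding edges_within_def using edge by blast
  qed
  also have "\<dots> \<le> arboricity G * card (X \<union> K)"
    using card_edges_within_le_arboricity[OF G] X KV by simp
  also have "\<dots> = arboricity G * (card X + card K)"
    using X finX finK by (simp add: card_Un_disjoint)
  finally show ?thesis .
qed

lemma card_high_verts_outside_cover_le:
  fixes \<alpha> \<eta> :: real
  assumes \<eta>: "\<eta> > 0" and G: "simple_graph G" and arb: "real (arboricity G) \<le> \<alpha>"
    and cover: "vertex_cover G K"
  shows "real (card (high_verts G ((1 + 1 / \<eta>) * (2 * \<alpha>)) - K)) \<le> \<eta> * real (card K)"
proof -
  define \<Lambda> where "\<Lambda> = (1 + 1 / \<eta>) * (2 * \<alpha>)"
  define X where "X = high_verts G \<Lambda> - K"
  have \<alpha>: "\<alpha> \<ge> 0" using arb by linarith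
  have XV: "X \<subseteq> verts G" by (auto simp: X_def high_verts_def)
  have finX: "finite X" using G XV finite_subset by (auto simp: simple_graph_def)
  have sum_le: "(\<Sum>v\<in>X. real (degree G v)) \<le> \<alpha> * (card X + card K)"
  proof -
    have "(\<Sum>v\<in>X. degree G v) \<le> arboricity G * (card X + card K)"
      using sum_degree_outside_cover_le[OF G cover XV] by (auto simp: X_def)
    then have "real (\<Sum>v\<in>X. degree G v) \<le> real (arboricity G) * real (card X + card K)"
      by (metis of_nat_le_iff of_nat_mult)
    also have "\<dots> \<le> \<alpha> * real (card X + card K)"
      using arb by (intro mult_right_mono) auto
    finally show ?thesis by simp
  qed
  have "real (card X) \<le> \<eta> * real (card K)"
  proof (cases "X = {}")
    case True
    then show ?thesis using \<eta> by simp
  next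
    case False
    have "(\<Sum>v\<in>X. \<Lambda>) < (\<Sum>v\<in>X. real (degree G v))"
      using finX False by (rule sum_strict_mono) (simp add: X_def high_verts_def)
    then have "card X * \<Lambda> < (\<Sum>v\<in>X. real (degree G v))" by simp
    with sum_le have less: "card X * \<Lambda> < \<alpha> * (card X + card K)" by simp
    \<comment> \<open>For \<alpha> = 0 both sides of the strict inequality would vanish. Hence
      \<alpha> is positive and can be cancelled.\<close>
    then have "\<alpha> \<noteq> 0" by (auto simp: \<Lambda>_def)
    with \<alpha> have "\<alpha> > 0" by simp
    have "\<alpha> * (card X * ((1 + 1 / \<eta>) * 2)) < \<alpha> * (card X + card K)"
      using less by (simp add: \<Lambda>_def mult_ac)
    then have "card X * ((1 + 1 / \<eta>) * 2) < real (card X) + card K"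
      using \<open>\<alpha> > 0\<close> by simp
    moreover have "0 \<le> real (card X) / \<eta>" using \<eta> by simp
    moreover have "card X * ((1 + 1 / \<eta>) * 2) = 2 * real (card X) + 2 * (real (card X) / \<eta>)"
      by (simp add: algebra_simps)
    \<comment> \<open>The inequality now reads |X| + 2|X|/\<eta> < |K|; dropping nonnegative terms
      on the left leaves the claim.\<close>
    ultimately have "real (card X) / \<eta> \<le> card K" by linarith
    then show ?thesis using \<eta> by (simp add: field_simps)
  qed
  then show ?thesis by (simp add: X_def \<Lambda>_def)
qed

section \<open>The combined cover and its size\<close>

lemma vertex_cover_Un_high_verts:
  assumes G: "simple_graph G" and low: "low_graph G \<Lambda> \<preceq> H" and sub: "H \<preceq> G"
    and C: "vertex_cover H C"
  shows "vertex_cover G (C \<union> high_verts G \<Lambda>)"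
  unfolding vertex_cover_def
proof (intro conjI ballI)
  show "C \<union> high_verts G \<Lambda> \<subseteq> verts G"
    using C sub by (auto simp: vertex_cover_def subgraph_def high_verts_def)
  fix e assume e: "e \<in> edges G"
  show "e \<inter> (C \<union> high_verts G \<Lambda>) \<noteq> {}"
  \<comment> \<open>An edge with two low endpoints survives in \<open>H\<close> and is met by
    \<open>C\<close>; any other edge has an endpoint of high degree.\<close>
  proof (cases "e \<subseteq> low_verts G \<Lambda>")
    case True
    then have "e \<in> edges H"
      using e low by (auto simp: subgraph_def low_graph_def edges_within_def)
    then show ?thesis using C by (auto simp: vertex_cover_def)
  next
    case False
    then show ?thesis using e G by (fastforce simp: low_verts_def high_verts_def simple_graph_def)
  qed
qed

theorem theorem5p2:
  fixes G H :: "'a ugraph"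
    and C :: "'a set"
    and \<alpha> \<beta> \<zeta> \<eta> \<Lambda> :: real
  assumes "\<eta> > 0"
    and "\<beta> \<ge> 0"
    and "simple_graph G"
    and "real (arboricity G) \<le> \<alpha>"
    and "\<Lambda> = (1 + 1 / \<eta>) * (2 * \<alpha>)"
    and "simple_graph H"
    and "low_graph G \<Lambda> \<preceq> H"
    and "H \<preceq> G"
    and "approx_vertex_cover \<beta> \<zeta> H C"
  shows "vertex_cover G (C \<union> high_verts G \<Lambda>) \<and>
         real (card (C \<union> high_verts G \<Lambda>)) \<le> (1 + \<beta> + \<eta>) * real (OPT G) + \<zeta>"
proof
  have C: "vertex_cover H C" and cardC: "real (card C) \<le> \<beta> * real (OPT H) + \<zeta>"
    using assms(9) by (auto simp: approx_vertex_cover_def)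
  show "vertex_cover G (C \<union> high_verts G \<Lambda>)"
    using assms C by (intro vertex_cover_Un_high_verts) auto
  obtain K where K: "vertex_cover G K" "card K = OPT G"
    using OPT_attained[OF assms(3)] by blast
  \<comment> \<open>\<open>K\<close> must also lie in \<open>verts H\<close>:
    \<open>low_graph\<close> keeps all vertices of \<open>G\<close>, so \<open>H\<close> has the
    same vertex set as \<open>G\<close>.\<close>
  have "vertex_cover H K"
    using K(1) assms(7,8) by (auto simp: vertex_cover_def subgraph_def low_graph_def)
  then have "OPT H \<le> OPT G"
    using OPT_le_card K(2) by metis
  then have OPT: "\<beta> * real (OPT H) \<le> \<beta> * real (OPT G)"
    using assms(2) by (simp add: mult_left_mono)
  have fin: "finite (verts G)" using assms(3) by (simp add: simple_graph_def)
  \<comment> \<open>High-degree vertices inside the optimal cover \<open>K\<close> are charged to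
    \<open>K\<close> itself. The three parts \<open>C\<close>, \<open>K\<close> and the remaining
    high-degree vertices contribute the coefficients \<beta>, 1 and \<eta>, and \<open>C\<close>
    also the additive \<zeta>.\<close>
  have "C \<union> K \<union> (high_verts G \<Lambda> - K) \<subseteq> verts G"
    using C K(1) assms(8) by (auto simp: vertex_cover_def subgraph_def high_verts_def)
  then have "finite (C \<union> K \<union> (high_verts G \<Lambda> - K))"
    using fin by (rule finite_subset)
  then have "card (C \<union> high_verts G \<Lambda>) \<le> card (C \<union> K \<union> (high_verts G \<Lambda> - K))"
    by (intro card_mono) auto
  also have "\<dots> \<le> card C + card K + card (high_verts G \<Lambda> - K)"
    by (meson add_mono card_Un_le le_refl order_trans)
  finally have "real (card (C \<union> high_verts G \<Lambda>)) \<le> card C + card K + card (high_verts G \<Lambda> - K)"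
    by linarith
  moreover have "real (card (high_verts G \<Lambda> - K)) \<le> \<eta> * real (OPT G)"
    using card_high_verts_outside_cover_le[OF assms(1,3,4) K(1)] assms(5) K(2) by simp
  ultimately show "real (card (C \<union> high_verts G \<Lambda>)) \<le> (1 + \<beta> + \<eta>) * real (OPT G) + \<zeta>"
    using cardC OPT K(2) by (simp add: algebra_simps)
qed

end
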